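(* Let $\mathbf{p}_1,\ldots,\mathbf{p}_d\in\Pi^n_o$ and let $\mathcal{A}\in\otimes^d\mathbb{R}^n$ be a positive tensor (all entries positive) with minimum entry equal to $\eta$. Let $\varepsilon\in(0,1/2)$ be given. Run the Sinkhorn algorithm (described in the context) with $\mathcal{A}_0=\frac{1}{\|\mathcal{A}\|_1}\mathcal{A}$, and let $k^{stop}\ge 0$ be the first $k\ge0$ for which $$\max\Big\{\Big\|\mathbf{s}_j(\mathcal{A}_{k})-\frac{\langle\mathbf{s}_j(\mathcal{A}_{k}),\mathbf{p}_j\rangle}{\|\mathbf{p}_j\|^2}\mathbf{p}_j\Big\|_1:\ j\in[d]\Big\}<\varepsilon .$$ Then $$k^{stop}\le\frac{2(\sqrt{n}+1)^2}{\varepsilon^2}\log\frac{\|\mathcal{A}\|_1}{\eta}.$$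
   Context: $[n]=\{1,\ldots,n\}$, $d\ge2$. $\otimes^d\mathbb{R}^n$ is the space of real tensors $\mathcal{A}=[a_{i_1,\ldots,i_d}]$, $i_1,\ldots,i_d\in[n]$. $\|\mathcal{A}\|_1$ is the sum of absolute values of all entries; $\|\cdot\|_1$, $\|\cdot\|$ are the $\ell_1$ and Euclidean norms of vectors. $\Pi^n_o$ is the set of probability vectors in $\mathbb{R}^n$ with all coordinates positive; $\mathbf{p}_j=(p_{1,j},\ldots,p_{n,j})$. For $l\in[d]$, $\mathbf{s}_l(\mathcal{A})=(s_{1,l}(\mathcal{A}),\ldots,s_{n,l}(\mathcal{A}))$ with $s_{i_l,l}(\mathcal{A})=\sum_{i_j\in[n],\,j\ne l}a_{i_1,\ldots,i_d}$. Sinkhorn algorithm started at a tensor $\mathcal{A}_0=[a_{i_1,\ldots,i_d,0}]$: for a tensor $\mathcal{F}$ with positive marginals let $\mathbf{x}_l(\mathcal{F})\in\mathbb{R}^n$ have coordinates $x_{i,l}(\mathcal{F})=\log p_{i,l}-\log s_{i,l}(\mathcal{F})$. Start with $X^{(0)}=\mathbf{0}\in(\mathbb{R}^n)^d$. Given $X^{(k-1)}=(\mathbf{x}_1^{(k-1)},\ldots,\mathbf{x}_d^{(k-1)})$, $k\in\mathbb{N}$, put $\mathcal{A}_{k-1}=[\exp(\sum_{j\in[d]}x^{(k-1)}_{i_j,j})\,a_{i_1,\ldots,i_d,0}]$, choose $$\ell(k-1)\in\arg\max\Big\{\Big\|\mathbf{s}_j(\mathcal{A}_{k-1})-\frac{\langle\mathbf{s}_j(\mathcal{A}_{k-1}),\mathbf{p}_j\rangle}{\|\mathbf{p}_j\|^2}\mathbf{p}_j\Big\|_1:\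 j\in[d]\Big\},$$ and set $\mathbf{x}^{(k)}_j=\mathbf{x}^{(k-1)}_j$ for $j\ne\ell(k-1)$, and $\mathbf{x}^{(k)}_j=\mathbf{x}^{(k-1)}_j+\mathbf{x}_j(\mathcal{A}_{k-1})$ for $j=\ell(k-1)$. *)

theory Defs
  imports "HOL-Analysis.Analysis"
begin

text \<open>
  The index sets $[n]$ and $[d]$ are finite types \<open>'n\<close> and \<open>'d\<close>; a multi-index
  $(i_1,\ldots,i_d)$ is a function \<open>'d \<Rightarrow> 'n\<close>, and a $d$-tuple of vectors in $R^n$ is a
  function \<open>'d \<Rightarrow> real ^ 'n\<close>.
\<close>

type_synonym ('d, 'n) tensor = "('d \<Rightarrow> 'n) \<Rightarrow> real"

definition l1_norm :: "real ^ 'n::finite \<Rightarrow> real" where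
  "l1_norm v = (\<Sum>i\<in>UNIV. \<bar>v $ i\<bar>)"

definition tensor_l1_norm :: "('d::finite, 'n::finite) tensor \<Rightarrow> real" where
  "tensor_l1_norm A = (\<Sum>i\<in>UNIV. \<bar>A i\<bar>)"

definition pos_prob_vec :: "real ^ 'n::finite \<Rightarrow> bool" where
  "pos_prob_vec p \<longleftrightarrow> (\<forall>i. 0 < p $ i) \<and> (\<Sum>i\<in>UNIV. p $ i) = 1"

definition marginal :: "'d \<Rightarrow> ('d::finite, 'n::finite) tensor \<Rightarrow> real ^ 'n" where
  "marginal l A = (\<chi> r. \<Sum>i | i l = r. A i)"

definition deviation ::
    "('d::finite \<Rightarrow> real ^ 'n::finite) \<Rightarrow> ('d, 'n) tensor \<Rightarrow> 'd \<Rightarrow> real" where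
  "deviation p A j =
     l1_norm (marginal j A - ((marginal j A \<bullet> p j) / (norm (p j))\<^sup>2) *\<^sub>R p j)"

definition scaling_step ::
    "('d::finite \<Rightarrow> real ^ 'n::finite) \<Rightarrow> ('d, 'n) tensor \<Rightarrow> 'd \<Rightarrow> real ^ 'n" where
  "scaling_step p F l = (\<chi> r. ln (p l $ r) - ln (marginal l F $ r))"

definition scaled_tensor ::
    "('d::finite, 'n::finite) tensor \<Rightarrow> ('d \<Rightarrow> real ^ 'n) \<Rightarrow> ('d, 'n) tensor" where
  "scaled_tensor A0 X = (\<lambda>i. exp (\<Sum>j\<in>UNIV. X j $ i j) * A0 i)"

text \<open>
  The iterates $X^{(k)}$ for a given sequence \<open>ell\<close> of updated modes, where \<open>ell k\<close> is
  the mode changed in passing from $X^{(k)}$ to $X^{(k+1)}$. Which sequences the algorithm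
  may produce (ties in the arg max are broken arbitrarily) is specified by \<open>sinkhorn_modes\<close>.
\<close>

primrec sinkhorn_iterate ::
    "('d::finite \<Rightarrow> real ^ 'n::finite) \<Rightarrow> ('d, 'n) tensor \<Rightarrow> (nat \<Rightarrow> 'd) \<Rightarrow> nat
      \<Rightarrow> 'd \<Rightarrow> real ^ 'n" where
  "sinkhorn_iterate p A0 ell 0 = (\<lambda>j. 0)"
| "sinkhorn_iterate p A0 ell (Suc k) =
     (let X = sinkhorn_iterate p A0 ell k in
      X(ell k := X (ell k) + scaling_step p (scaled_tensor A0 X) (ell k)))"

definition sinkhorn_tensor ::
    "('d::finite \<Rightarrow> real ^ 'n::finite) \<Rightarrow> ('d, 'n) tensor \<Rightarrow> (nat \<Rightarrow> 'd) \<Rightarrow> nat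
      \<Rightarrow> ('d, 'n) tensor" where
  "sinkhorn_tensor p A0 ell k = scaled_tensor A0 (sinkhorn_iterate p A0 ell k)"

definition sinkhorn_modes ::
    "('d::finite \<Rightarrow> real ^ 'n::finite) \<Rightarrow> ('d, 'n) tensor \<Rightarrow> (nat \<Rightarrow> 'd) \<Rightarrow> bool" where
  "sinkhorn_modes p A0 ell \<longleftrightarrow>
     (\<forall>k. is_arg_max (deviation p (sinkhorn_tensor p A0 ell k)) (\<lambda>j. True) (ell k))"

definition max_deviation ::
    "('d::finite \<Rightarrow> real ^ 'n::finite) \<Rightarrow> ('d, 'n) tensor \<Rightarrow> real" where
  "max_deviation p A = Max (range (deviation p A))"

end

theory Submission
  imports Defs
begin

text \<open>
  Every iterate $A_k$ has total mass 1. Hence each entry of $A_k$ is at most 1, which gives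
  $\sum_j x_j^{(k)}(i_j) \le \log(\|A\|_1/\eta)$ for every multi-index; choosing each $i_j$ to
  maximise $x_j^{(k)}$ bounds the dual potential $\sum_j \langle p_j, x_j^{(k)}\rangle$ by
  $\log(\|A\|_1/\eta)$. A step in mode $l$ raises this potential, which starts at 0, by the
  Kullback-Leibler divergence of $p_l$ from the current marginal $s_l$. By Pinsker's inequality
  the increase is at least $\|s_l - p_l\|_1^2 / 2$, and
  $\|s_l - p_l\|_1 \ge (\sqrt n + 1)^{-1}$ times the deviation, because the orthogonal
  projection onto the line of $p_l$ has norm at most $\sqrt n$ in the sum norm.
\<close>

section \<open>Pinsker's inequality\<close>

lemma pinsker_pointwise_unit:
  fixes t :: real
  assumes "0 < t"
  shows "3 * (t - 1)\<^sup>2 \<le> (2 * t + 4) * (t * ln t - t + 1)"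
proof -
  \<comment> \<open>Since (t - 1)^2 / (t + 2) = t - 4 + 9 / (t + 2), the claim is that
    \<open>g\<close> is nonnegative. Both \<open>g\<close> and \<open>g'\<close> vanish at 1, so
    convexity of \<open>g\<close> suffices.\<close>
  define g where "g = (\<lambda>t::real. t * ln t - t + 1 - 3 / 2 * (t - 4 + 9 / (t + 2)))"
  define g' where "g' = (\<lambda>t::real. ln t - 3 / 2 * (1 - 9 / (t + 2)\<^sup>2))"
  define g'' where "g'' = (\<lambda>t::real. 1 / t - 27 / (t + 2) ^ 3)"
  have d1: "(g has_real_derivative g' x) (at x)" if "x \<in> {0<..}" for x
    using that unfolding g_def g'_def
    by (auto intro!: derivative_eq_intros simp: field_simps power2_eq_square)
  have d2: "(g' has_real_derivative g'' x) (at x)" if "x \<in> {0<..}" for x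
  proof -
    have "(g' has_real_derivative 1 / x - 3 / 2 * (9 * (2 * (x + 2)) / ((x + 2)\<^sup>2)\<^sup>2)) (at x)"
      using that unfolding g'_def
      by (auto intro!: derivative_eq_intros simp: power2_eq_square)
        (simp_all add: divide_simps, simp_all add: algebra_simps)
    also have "9 * (2 * (x + 2)) / ((x + 2)\<^sup>2)\<^sup>2 = 18 / (x + 2) ^ 3"
      using that by (simp add: frac_eq_eq) (simp add: eval_nat_numeral algebra_simps)
    finally show ?thesis by (simp add: g''_def)
  qed
  have pos: "0 \<le> g'' x" if "x \<in> {0<..}" for x
  proof -
    \<comment> \<open>This is the arithmetic-geometric mean inequality for x, 1, 1 with an explicit
      remainder.\<close>
    have "(x + 2) ^ 3 - 27 * x = (x - 1)\<^sup>2 * (x + 8)"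
      by (simp add: algebra_simps power2_eq_square power3_eq_cube)
    then have "27 * x \<le> (x + 2) ^ 3"
      using that by (smt (verit) greaterThan_iff mult_nonneg_nonneg zero_le_power2)
    then show ?thesis
      using that by (simp add: g''_def field_simps)
  qed
  have conv: "convex_on {0<..} g"
    using d1 d2 pos by (intro f''_ge0_imp_convex) auto
  have "g' 1 * (t - 1) \<le> g t - g 1"
    using conv d1[of 1] assms
    by (intro convex_on_imp_above_tangent[where A = "{0<..}"])
      (auto intro: has_field_derivative_at_within simp: connected_Ioi interior_open)
  then have "0 \<le> g t"
    by (simp add: g_def g'_def)
  then have "0 \<le> (2 * t + 4) * g t"
    using assms by simp
  also have "(2 * t + 4) * g t = (2 * t + 4) * (t * ln t - t + 1) - 3 * (t - 1)\<^sup>2"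
  proof -
    have "(2 * t + 4) * (3 / 2 * (t - 4 + 9 / (t + 2))) = 3 * (t - 1)\<^sup>2"
      using assms by (simp add: field_simps power2_eq_square)
    then show ?thesis by (simp add: g_def right_diff_distrib)
  qed
  finally show ?thesis by simp
qed

text \<open>Both sides are homogeneous of degree 2 in (p, s), so the one-variable inequality at t =
  p / s, multiplied by s^2, gives the claim.\<close>

lemma pinsker_pointwise:
  fixes p s :: real
  assumes "0 < p" "0 < s"
  shows "3 * (p - s)\<^sup>2 \<le> (2 * p + 4 * s) * (p * (ln p - ln s) - p + s)"
proof -
  have "s\<^sup>2 * (3 * (p / s - 1)\<^sup>2)
      \<le> s\<^sup>2 * ((2 * (p / s) + 4) * (p / s * ln (p / s) - p / s + 1))"
    using assms by (intro mult_left_mono pinsker_pointwise_unit) auto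
  moreover have "s\<^sup>2 * (3 * (p / s - 1)\<^sup>2) = 3 * (p - s)\<^sup>2"
    using assms by (simp add: power2_eq_square field_simps)
  moreover have "s\<^sup>2 * ((2 * (p / s) + 4) * (p / s * ln (p / s) - p / s + 1))
      = (2 * p + 4 * s) * (p * (ln p - ln s) - p + s)"
    using assms by (simp add: ln_div power2_eq_square field_simps)
  ultimately show ?thesis by simp
qed

text \<open>The pointwise bound has the form (s_i - p_i)^2 \<le> u_i w_i, so Cauchy-Schwarz bounds
  the squared sum norm by the product of the sums of u and w. For probability vectors the u_i add up
  to (2 + 4) / 3 = 2, and the linear terms of the w_i cancel, leaving the divergence.\<close>

lemma pinsker:
  fixes p s :: "real ^ 'n::finite"
  assumes "pos_prob_vec p" "pos_prob_vec s"
  shows "(l1_norm (s - p))\<^sup>2 \<le> 2 * (\<Sum>i\<in>UNIV. p $ i * (ln (p $ i) - ln (s $ i)))"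
proof -
  define u where "u i = (2 * p $ i + 4 * s $ i) / 3" for i
  define w where "w i = p $ i * (ln (p $ i) - ln (s $ i)) - p $ i + s $ i" for i
  have pos: "0 < p $ i" "0 < s $ i" for i
    using assms by (auto simp: pos_prob_vec_def)
  have sums: "(\<Sum>i\<in>UNIV. p $ i) = 1" "(\<Sum>i\<in>UNIV. s $ i) = 1"
    using assms by (auto simp: pos_prob_vec_def)
  have u: "0 < u i" for i
    using pos[of i] by (simp add: u_def)
  have sq: "(s $ i - p $ i)\<^sup>2 \<le> u i * w i" for i
    using pinsker_pointwise[OF pos(1)[of i] pos(2)[of i]]
    by (simp add: u_def w_def power2_commute)
  \<comment> \<open>Nonnegativity of \<open>w i\<close> is read off from \<open>sq\<close>, as
    \<open>u i\<close> is positive; it lets \<open>sqrt (w i)\<close> square back to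
    \<open>w i\<close> below.\<close>
  have w: "0 \<le> w i" for i
    using order_trans[OF zero_le_power2 sq[of i]] u[of i] by (simp add: zero_le_mult_iff)
  have abs: "\<bar>s $ i - p $ i\<bar> \<le> sqrt (u i) * sqrt (w i)" for i
    using real_sqrt_le_mono[OF sq[of i]] by (simp add: real_sqrt_mult)
  have "(l1_norm (s - p))\<^sup>2 \<le> (\<Sum>i\<in>UNIV. sqrt (u i) * sqrt (w i))\<^sup>2"
    unfolding l1_norm_def using abs by (intro power_mono sum_mono sum_nonneg) auto
  also have "\<dots> \<le> (\<Sum>i\<in>UNIV. (sqrt (u i))\<^sup>2) * (\<Sum>i\<in>UNIV. (sqrt (w i))\<^sup>2)"
    by (rule Cauchy_Schwarz_ineq_sum)
  also have "\<dots> = (\<Sum>i\<in>UNIV. u i) * (\<Sum>i\<in>UNIV. w i)"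
    using u w by (simp add: less_imp_le)
  also have "(\<Sum>i\<in>UNIV. u i) = 2"
    using sums by (simp add: u_def sum.distrib flip: sum_divide_distrib sum_distrib_left)
  also have "(\<Sum>i\<in>UNIV. w i) = (\<Sum>i\<in>UNIV. p $ i * (ln (p $ i) - ln (s $ i)))"
    using sums by (simp add: w_def sum.distrib sum_subtractf)
  finally show ?thesis .
qed

section \<open>Deviation versus distance to the target marginal\<close>

lemma l1_norm_le_norm:
  fixes v :: "real ^ 'n::finite"
  shows "l1_norm v \<le> sqrt (real CARD('n)) * norm v"
proof -
  have "(l1_norm v)\<^sup>2 \<le> real CARD('n) * (\<Sum>i\<in>UNIV. \<bar>v $ i\<bar>\<^sup>2)"
    unfolding l1_norm_def using sum_squared_le_sum_of_squares[of "\<lambda>i. \<bar>v $ i\<bar>" UNIV]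
    by (simp add: mult.commute)
  also have "\<dots> = (sqrt (real CARD('n)) * norm v)\<^sup>2"
    by (simp add: power_mult_distrib norm_vec_def L2_set_def sum_nonneg)
  finally show ?thesis
    by (rule power2_le_imp_le) simp
qed

lemma deviation_le_l1_norm:
  fixes p :: "'d::finite \<Rightarrow> real ^ 'n::finite"
  assumes "pos_prob_vec (p j)"
  shows "deviation p F j \<le> (sqrt (real CARD('n)) + 1) * l1_norm (marginal j F - p j)"
proof -
  define q where "q = p j"
  define v where "v = marginal j F - q"
  define c where "c = (v \<bullet> q) / (norm q)\<^sup>2"
  have q1: "l1_norm q = 1"
    using assms unfolding q_def by (simp add: pos_prob_vec_def l1_norm_def abs_of_pos)
  have "q \<noteq> 0"
    using q1 by (auto simp: l1_norm_def)
  \<comment> \<open>The projection fixes q, so the marginal and v = marginal - q leave the same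
    residual; their coefficients along q differ by exactly 1.\<close>
  have "(marginal j F \<bullet> q) / (norm q)\<^sup>2 = c + 1"
    using \<open>q \<noteq> 0\<close>
    by (simp add: c_def v_def inner_diff_left diff_divide_distrib power2_norm_eq_inner)
  then have "deviation p F j = l1_norm (v - c *\<^sub>R q)"
    by (simp add: deviation_def v_def algebra_simps flip: q_def)
  also have "\<dots> \<le> l1_norm v + \<bar>c\<bar> * l1_norm q"
    unfolding l1_norm_def sum_distrib_left sum.distrib[symmetric]
    by (intro sum_mono) (simp add: abs_mult[symmetric] abs_triangle_ineq4)
  also have "\<bar>c\<bar> * l1_norm q \<le> sqrt (real CARD('n)) * l1_norm v"
  proof -
    have "\<bar>c\<bar> \<le> norm v * norm q / (norm q)\<^sup>2"
      unfolding c_def abs_divide by (simp add: divide_right_mono Cauchy_Schwarz_ineq2)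
    also have "\<dots> = norm v * (1 / norm q)"
      using \<open>q \<noteq> 0\<close> by (simp add: power2_eq_square)
    also have "\<dots> \<le> l1_norm v * sqrt (real CARD('n))"
    proof (rule mult_mono)
      show "norm v \<le> l1_norm v"
        unfolding l1_norm_def by (rule norm_le_l1_cart)
      \<comment> \<open>A vector of sum norm 1 has Euclidean norm at least 1 / sqrt n; this is the
        source of the factor sqrt n.\<close>
      show "1 / norm q \<le> sqrt (real CARD('n))"
        using l1_norm_le_norm[of q] q1 \<open>q \<noteq> 0\<close> by (simp add: divide_le_eq)
    qed (auto simp: l1_norm_def sum_nonneg)
    finally show ?thesis using q1 by (simp add: mult.commute)
  qed
  finally show ?thesis
    by (simp add: v_def q_def algebra_simps)
qed

section \<open>Marginals and total mass of the iterates\<close>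

lemma sum_marginal: "(\<Sum>r\<in>UNIV. marginal l F $ r) = sum F UNIV"
  unfolding marginal_def
  using sum.group[of UNIV UNIV "\<lambda>i. i l" F] by simp

lemma marginal_pos:
  assumes "\<And>i. 0 < F i"
  shows "0 < marginal l F $ r"
proof -
  \<comment> \<open>The constant multi-index shows that the slice is nonempty, so its sum is
    strictly positive.\<close>
  have "(\<lambda>_. r) \<in> {i. i l = r}" by simp
  then show ?thesis
    unfolding marginal_def vec_lambda_beta using assms by (intro sum_pos) auto
qed

lemma pos_prob_vec_marginal:
  assumes "\<And>i. 0 < F i" "sum F UNIV = 1"
  shows "pos_prob_vec (marginal l F)"
  using assms by (simp add: pos_prob_vec_def marginal_pos sum_marginal)

lemma scaled_tensor_fun_upd:
  "scaled_tensor A0 (X(l := X l + y)) i = exp (y $ i l) * scaled_tensor A0 X i"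
proof -
  have "(\<Sum>j\<in>UNIV. (X(l := X l + y)) j $ i j) = (\<Sum>j\<in>UNIV. X j $ i j + (if j = l then y $ i l else 0))"
    by (intro sum.cong) auto
  also have "\<dots> = (\<Sum>j\<in>UNIV. X j $ i j) + y $ i l"
    by (simp add: sum.distrib)
  finally show ?thesis
    by (simp add: scaled_tensor_def exp_add)
qed

text \<open>The update multiplies the whole slice \<open>i l = r\<close> by one factor, the target
  value divided by the current marginal value.\<close>

lemma marginal_scaling_step:
  assumes "pos_prob_vec (p l)" "\<And>i. 0 < scaled_tensor A0 X i"
  shows "marginal l (scaled_tensor A0 (X(l := X l + scaling_step p (scaled_tensor A0 X) l))) = p l"
proof (rule vec_eq_iff[THEN iffD2], rule allI)
  fix r
  let ?F = "scaled_tensor A0 X"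
  let ?s = "marginal l ?F $ r"
  have s: "0 < ?s" using assms(2) by (rule marginal_pos)
  have p: "0 < p l $ r" using assms(1) by (simp add: pos_prob_vec_def)
  have "marginal l (scaled_tensor A0 (X(l := X l + scaling_step p ?F l))) $ r
      = (\<Sum>i | i l = r. exp (ln (p l $ r) - ln ?s) * ?F i)"
    unfolding marginal_def scaled_tensor_fun_upd scaling_step_def by simp
  also have "\<dots> = exp (ln (p l $ r) - ln ?s) * ?s"
    by (simp add: marginal_def sum_distrib_left)
  also have "\<dots> = p l $ r"
    using s p by (simp add: exp_diff)
  finally show "marginal l (scaled_tensor A0 (X(l := X l + scaling_step p ?F l))) $ r = p l $ r" .
qed

lemma sinkhorn_tensor_pos:
  assumes "\<And>i. 0 < A0 i"
  shows "0 < sinkhorn_tensor p A0 ell k i"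
  using assms by (simp add: sinkhorn_tensor_def scaled_tensor_def)

lemma sum_sinkhorn_tensor:
  assumes "\<And>j. pos_prob_vec (p j)" "\<And>i. 0 < A0 i" "sum A0 UNIV = 1"
  shows "sum (sinkhorn_tensor p A0 ell k) UNIV = 1"
proof (cases k)
  case 0
  then show ?thesis
    using assms(3) by (simp add: sinkhorn_tensor_def scaled_tensor_def)
next
  case (Suc m)
  \<comment> \<open>The last update alone settles the mass: it makes one marginal a probability
    vector, and every marginal has the same total as the tensor.\<close>
  have "marginal (ell m) (sinkhorn_tensor p A0 ell (Suc m)) = p (ell m)"
    unfolding sinkhorn_tensor_def sinkhorn_iterate.simps Let_def
    using assms(2) by (intro marginal_scaling_step assms(1)) (simp add: scaled_tensor_def)
  then show ?thesis
    using Suc sum_marginal[of "ell m" "sinkhorn_tensor p A0 ell k"] assms(1)[of "ell m"]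
    by (simp add: pos_prob_vec_def)
qed

section \<open>The dual potential: upper bound and gain per step\<close>

definition potential :: "('d::finite \<Rightarrow> real ^ 'n::finite) \<Rightarrow> ('d \<Rightarrow> real ^ 'n) \<Rightarrow> real" where
  "potential p X = (\<Sum>j\<in>UNIV. p j \<bullet> X j)"

lemma potential_fun_upd: "potential p (X(l := X l + y)) = potential p X + p l \<bullet> y"
proof -
  have "potential p (X(l := X l + y)) = (\<Sum>j\<in>UNIV. p j \<bullet> X j + (if j = l then p l \<bullet> y else 0))"
    unfolding potential_def by (intro sum.cong) (auto simp: inner_add_right)
  also have "\<dots> = potential p X + p l \<bullet> y"
    by (simp add: potential_def sum.distrib)
  finally show ?thesis .
qed

lemma inner_le_Max:
  assumes "pos_prob_vec p"
  shows "p \<bullet> x \<le> Max (range (($) x))"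
proof -
  have "p \<bullet> x \<le> (\<Sum>i\<in>UNIV. p $ i * Max (range (($) x)))"
    unfolding inner_vec_def inner_real_def
    using assms by (intro sum_mono mult_left_mono) (auto simp: pos_prob_vec_def less_imp_le)
  also have "\<dots> = Max (range (($) x))"
    using assms by (simp add: pos_prob_vec_def flip: sum_distrib_right)
  finally show ?thesis .
qed

lemma potential_le_if_scaled_tensor_le_1:
  assumes "\<And>j. pos_prob_vec (p j)" "0 < c" "\<And>i. c \<le> A0 i" "\<And>i. scaled_tensor A0 X i \<le> 1"
  shows "potential p X \<le> - ln c"
proof -
  have "\<exists>r. X j $ r = Max (range (($) (X j)))" for j
    using Max_in[of "range (($) (X j))"] by fastforce
  \<comment> \<open>The coordinates of a multi-index are independent, so a single one maximises all
    the \<open>X j\<close> simultaneously.\<close>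
  then obtain i where i: "\<And>j. X j $ i j = Max (range (($) (X j)))"
    by metis
  have "potential p X \<le> (\<Sum>j\<in>UNIV. X j $ i j)"
    unfolding potential_def i by (intro sum_mono inner_le_Max assms(1))
  moreover have "exp (\<Sum>j\<in>UNIV. X j $ i j) * c \<le> 1"
    using mult_left_mono[OF assms(3)[of i], of "exp (\<Sum>j\<in>UNIV. X j $ i j)"] assms(4)[of i]
    unfolding scaled_tensor_def by (meson exp_ge_zero order_trans)
  then have "(\<Sum>j\<in>UNIV. X j $ i j) \<le> ln (1 / c)"
    using assms(2) by (simp add: ln_ge_iff field_simps)
  ultimately show ?thesis
    using assms(2) by (simp add: ln_div)
qed

text \<open>The dual objective of the scaling problem is \<open>potential p X\<close> minus the mass
  of the scaled tensor. The mass stays 1 along the iterates, so the linear part alone measures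
  progress.\<close>

lemma potential_step:
  fixes p :: "'d::finite \<Rightarrow> real ^ 'n::finite"
  assumes p: "\<And>j. pos_prob_vec (p j)" and pos: "\<And>i. 0 < A0 i" and sum: "sum A0 UNIV = 1"
    and eps: "0 \<le> \<epsilon>" "\<epsilon> \<le> deviation p (sinkhorn_tensor p A0 ell k) (ell k)"
  shows "potential p (sinkhorn_iterate p A0 ell k) + \<epsilon>\<^sup>2 / (2 * (sqrt (real CARD('n)) + 1)\<^sup>2)
    \<le> potential p (sinkhorn_iterate p A0 ell (Suc k))"
proof -
  define l where "l = ell k"
  define F where "F = sinkhorn_tensor p A0 ell k"
  define D where "D = l1_norm (marginal l F - p l)"
  define K where "K = sqrt (real CARD('n)) + 1"
  have K: "0 < K"
    unfolding K_def by (simp add: add_nonneg_pos)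
  have s: "pos_prob_vec (marginal l F)"
    unfolding F_def by (intro pos_prob_vec_marginal sinkhorn_tensor_pos sum_sinkhorn_tensor p pos sum)
  have "\<epsilon> \<le> K * D"
    using eps(2) deviation_le_l1_norm[of p l F, OF p] unfolding K_def D_def F_def l_def by linarith
  then have "\<epsilon>\<^sup>2 \<le> K\<^sup>2 * D\<^sup>2"
    using power_mono[OF _ eps(1), of "K * D" 2] by (simp add: power_mult_distrib)
  then have "\<epsilon>\<^sup>2 / (2 * K\<^sup>2) \<le> D\<^sup>2 / 2"
    using K by (simp add: field_simps)
  \<comment> \<open>Written out, this inner product is the divergence of \<open>p l\<close> from the
    current marginal.\<close>
  also have "\<dots> \<le> p l \<bullet> scaling_step p F l"
    using pinsker[OF p[of l] s] by (simp add: D_def inner_vec_def scaling_step_def)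
  finally show ?thesis
    by (simp add: Let_def potential_fun_upd K_def F_def l_def sinkhorn_tensor_def)
qed

lemma potential_lower_bound:
  fixes p :: "'d::finite \<Rightarrow> real ^ 'n::finite"
  assumes "\<And>j. pos_prob_vec (p j)" "\<And>i. 0 < A0 i" "sum A0 UNIV = 1" "0 \<le> \<epsilon>"
    and "\<And>k. k < m \<Longrightarrow> \<epsilon> \<le> deviation p (sinkhorn_tensor p A0 ell k) (ell k)"
  shows "real m * (\<epsilon>\<^sup>2 / (2 * (sqrt (real CARD('n)) + 1)\<^sup>2))
    \<le> potential p (sinkhorn_iterate p A0 ell m)"
  using assms(5)
proof (induction m)
  case 0
  then show ?case by (simp add: potential_def)
next
  case (Suc m)
  have "\<epsilon> \<le> deviation p (sinkhorn_tensor p A0 ell m) (ell m)"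
    using Suc.prems by blast
  from potential_step[where p = p and ell = ell and k = m, OF assms(1-4) this] Suc.IH Suc.prems
  show ?case
    by (simp add: distrib_right add_divide_distrib del: sinkhorn_iterate.simps)
qed

section \<open>Counting steps and termination\<close>

lemma sinkhorn_steps_le:
  fixes p :: "'d::finite \<Rightarrow> real ^ 'n::finite"
  assumes p: "\<And>j. pos_prob_vec (p j)" and c: "0 < c" "\<And>i. c \<le> A0 i"
    and sum: "sum A0 UNIV = 1" and eps: "0 < \<epsilon>"
    and dev: "\<And>k. k < m \<Longrightarrow> \<epsilon> \<le> deviation p (sinkhorn_tensor p A0 ell k) (ell k)"
  shows "real m \<le> 2 * (sqrt (real CARD('n)) + 1)\<^sup>2 / \<epsilon>\<^sup>2 * ln (1 / c)"
proof -
  define K where "K = sqrt (real CARD('n)) + 1"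
  have K: "0 < K"
    unfolding K_def by (simp add: add_nonneg_pos)
  have pos: "\<And>i. 0 < A0 i"
    using c less_le_trans by blast
  have "sinkhorn_tensor p A0 ell m i \<le> 1" for i
    using member_le_sum[of i UNIV "sinkhorn_tensor p A0 ell m"]
      sinkhorn_tensor_pos[of A0, OF pos] sum_sinkhorn_tensor[OF p pos sum]
    by (simp add: less_imp_le)
  then have "potential p (sinkhorn_iterate p A0 ell m) \<le> - ln c"
    by (intro potential_le_if_scaled_tensor_le_1[where ?A0.0 = A0] p c)
      (auto simp: sinkhorn_tensor_def)
  moreover have "real m * (\<epsilon>\<^sup>2 / (2 * K\<^sup>2)) \<le> potential p (sinkhorn_iterate p A0 ell m)"
    unfolding K_def using eps by (intro potential_lower_bound p pos sum dev) auto
  ultimately have "real m * (\<epsilon>\<^sup>2 / (2 * K\<^sup>2)) \<le> ln (1 / c)"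
    using c(1) by (simp add: ln_div)
  then show ?thesis
    unfolding K_def[symmetric] using K eps by (simp add: field_simps)
qed

text \<open>This is where the arg max rule enters: as long as the stopping test fails, the mode
  actually updated has deviation at least \<epsilon>.\<close>

lemma max_deviation_eq:
  assumes "sinkhorn_modes p A0 ell"
  shows "max_deviation p (sinkhorn_tensor p A0 ell k)
    = deviation p (sinkhorn_tensor p A0 ell k) (ell k)"
  unfolding max_deviation_def
  using assms by (intro Max_eqI) (auto simp: sinkhorn_modes_def is_arg_max_linorder)

theorem theorem3p4:
  fixes p :: "'d::finite \<Rightarrow> real ^ 'n::finite"
    and A :: "('d, 'n) tensor"
    and \<eta> \<epsilon> :: real
    and A0 :: "('d, 'n) tensor"
    and ell :: "nat \<Rightarrow> 'd"
  assumes "2 \<le> CARD('d)"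
    and "\<And>j. pos_prob_vec (p j)"
    and "\<And>i. 0 < A i"
    and "\<eta> = Min (range A)"
    and "0 < \<epsilon>" and "\<epsilon> < 1 / 2"
    and "A0 = (\<lambda>i. (1 / tensor_l1_norm A) * A i)"
    and "sinkhorn_modes p A0 ell"
  shows "\<exists>kstop. max_deviation p (sinkhorn_tensor p A0 ell kstop) < \<epsilon>
           \<and> (\<forall>k<kstop. \<not> max_deviation p (sinkhorn_tensor p A0 ell k) < \<epsilon>)
           \<and> real kstop \<le> 2 * (sqrt (real CARD('n)) + 1)\<^sup>2 / \<epsilon>\<^sup>2
                            * ln (tensor_l1_norm A / \<eta>)"
proof -
  define S where "S = tensor_l1_norm A"
  define B where "B = 2 * (sqrt (real CARD('n)) + 1)\<^sup>2 / \<epsilon>\<^sup>2 * ln (S / \<eta>)"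
  define stop where "stop k \<longleftrightarrow> max_deviation p (sinkhorn_tensor p A0 ell k) < \<epsilon>" for k
  have S_eq: "S = sum A UNIV"
    using assms(3) by (simp add: S_def tensor_l1_norm_def abs_of_pos)
  have S: "0 < S"
    unfolding S_eq using assms(3) by (intro sum_pos) auto
  have \<eta>: "0 < \<eta>" "\<eta> \<le> A i" for i
    using assms(3) by (auto simp: assms(4))
  have A0: "A0 i = A i / S" for i
    by (simp add: assms(7) S_def)
  have sum: "sum A0 UNIV = 1"
    using S by (simp add: A0 S_eq flip: sum_divide_distrib)
  \<comment> \<open>Any initial run without a stop is bounded, whether or not it ends in one. This
    gives first the existence of a stopping index, by the Archimedean property, and then the
    estimate for the least such index.\<close>
  have bound: "real m \<le> B" if "\<forall>k<m. \<not> stop k" for m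
  proof -
    \<comment> \<open>The lower bound for the entries of \<open>A0\<close> is \<eta> / S, since
      normalisation divides every entry of \<open>A\<close> by S.\<close>
    have "real m \<le> 2 * (sqrt (real CARD('n)) + 1)\<^sup>2 / \<epsilon>\<^sup>2 * ln (1 / (\<eta> / S))"
    proof (rule sinkhorn_steps_le[OF assms(2)])
      show "\<epsilon> \<le> deviation p (sinkhorn_tensor p A0 ell k) (ell k)" if "k < m" for k
        using that \<open>\<forall>k<m. \<not> stop k\<close> max_deviation_eq[OF assms(8), of k]
        by (auto simp: stop_def not_less)
    qed (use S \<eta> sum assms(5) in \<open>auto simp: A0 divide_right_mono\<close>)
    then show ?thesis by (simp add: B_def)
  qed
  have "\<exists>k. stop k"
  proof (rule ccontr)
    assume "\<nexists>k. stop k"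
    moreover obtain m :: nat where "B < real m"
      using reals_Archimedean2 by blast
    ultimately show False
      using bound[of m] by auto
  qed
  then have "stop (LEAST k. stop k)"
    by (rule LeastI_ex)
  moreover have "\<forall>k<(LEAST k. stop k). \<not> stop k"
    using not_less_Least by blast
  ultimately show ?thesis
    using bound unfolding stop_def B_def S_def by blast
qed

end
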